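(* Fix $n\ge1$. Let $m_k$ and $M_k$ denote the smallest and the largest bus number, respectively, among all non-empty buses at time $k$ in the $n$-detachment process, and let $R_k:=M_k-m_k$. Then: (1) As $k\to\infty$, the law of $m_k/k$ converges to $\mathsf{Beta}(1,n)$ and the law of $M_k/k$ converges to $\mathsf{Beta}(n,1)$; that is, for $x\in[0,1]$, $$\lim_{k\to\infty}P\left(\frac{m_k}{k}\le x\right)=1-(1-x)^n,\qquad\lim_{k\to\infty}P\left(\frac{M_k}{k}\le x\right)=x^n.$$ (2) The expectations and standard deviations satisfy $$\lim_{k\to\infty} E(m_k/k)=\frac1{n+1},\qquad\lim_{k\to\infty} E(M_k/k)=\frac{n}{n+1},\qquad\lim_{k\to\infty} E(R_k/k)=\frac{n-1}{n+1},$$ $$\lim_{k\to\infty}\sigma(M_k/k)=\lim_{k\to\infty}\sigma(m_k/k)=\frac1{n+1}\sqrt{\frac{n}{n+2}}.$$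
   Context: The $n$-detachment process ($n\ge1$): there are $n$ labeled passengers. At time $1$ all passengers sit in bus number $1$. At each integer time $k\ge 2$, a new bus with number $k$ becomes available and each passenger (currently sitting in one of the buses $1,\dots,k-1$), independently of the others and of the past, relocates to bus $k$ with probability $1/k$ and otherwise stays where they are. $\sigma$ denotes standard deviation. *)

theory Defs
  imports "HOL-Probability.Probability"
begin

(* X k i is the number of the bus in which passenger i sits at time k (time starts at k = 1, so
   X 0 is irrelevant).  Since X (k - 1) i < k, passenger i relocates at time k iff X k i = k.
   The past before time k is generated by the relocation events at the times 2, ..., k - 1, so
   "independently of the others and of the past" is the mutual independence of all relocation
   events over all passengers and all times k >= 2. *)
locale detachment_process = prob_space M
  for M :: "'a measure" +
  fixes n :: nat and X :: "nat \<Rightarrow> nat \<Rightarrow> 'a \<Rightarrow> nat"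
  assumes rv: "k \<ge> 1 \<Longrightarrow> i \<in> {1..n} \<Longrightarrow> random_variable (count_space UNIV) (X k i)"
    and start: "i \<in> {1..n} \<Longrightarrow> \<omega> \<in> space M \<Longrightarrow> X 1 i \<omega> = 1"
    and step: "k \<ge> 2 \<Longrightarrow> i \<in> {1..n} \<Longrightarrow> \<omega> \<in> space M \<Longrightarrow> X k i \<omega> = k \<or> X k i \<omega> = X (k - 1) i \<omega>"
    and prob_relocate: "k \<ge> 2 \<Longrightarrow> i \<in> {1..n} \<Longrightarrow> \<P>(\<omega> in M. X k i \<omega> = k) = 1 / real k"
    and indep_relocate:
      "indep_events (\<lambda>(k, i). {\<omega> \<in> space M. X k i \<omega> = k}) ({2..} \<times> {1..n})"

lemma detachment_process_exists:
  "\<exists>(M :: (nat \<times> nat \<Rightarrow> bool) measure) X. detachment_process M n X"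
proof -
  define P where "P = (\<lambda>(k :: nat, i :: nat). measure_pmf (bernoulli_pmf (1 / real k)))"
  define M where "M = PiM (UNIV :: (nat \<times> nat) set) P"
  define X :: "nat \<Rightarrow> nat \<Rightarrow> (nat \<times> nat \<Rightarrow> bool) \<Rightarrow> nat" where
    "X = (\<lambda>k i \<omega>. rec_nat 0 (\<lambda>k b. if k = 0 \<or> \<omega> (Suc k, i) then Suc k else b) k)"
  have X0: "X 0 i \<omega> = 0"
    and XS: "X (Suc k) i \<omega> = (if k = 0 \<or> \<omega> (Suc k, i) then Suc k else X k i \<omega>)" for k i \<omega>
    by (simp_all add: X_def)
  have le: "X k i \<omega> \<le> k" for k i \<omega>
    by (induction k) (auto simp: X0 XS)
  have reloc: "X k i \<omega> = k \<longleftrightarrow> \<omega> (k, i)" if "k \<ge> 2" for k i \<omega>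
  proof -
    define j where "j = k - 1"
    then have "k = Suc j" "j \<noteq> 0" using that by auto
    then show ?thesis using le[of j i \<omega>] by (auto simp: XS)
  qed
  have P: "\<And>ki. prob_space (P ki)"
    by (auto simp: P_def split: prod.split intro: prob_space_measure_pmf)
  have comp: "distr (PiM UNIV P) (P ki) (\<lambda>\<omega>. \<omega> ki) = P ki" for ki
    by (rule distr_PiM_component) (auto simp: P)
  have sets_P[simp]: "sets (P ki) = UNIV" and space_P[simp]: "space (P ki) = UNIV" for ki
    by (auto simp: P_def split: prod.split)
  interpret prob_space M
    unfolding M_def by (rule prob_space_PiM) (rule P)
  have [simp]: "space M = UNIV"
    by (simp add: M_def space_PiM)
  have coord[measurable]: "(\<lambda>\<omega>. \<omega> ki) \<in> measurable M (count_space UNIV)" for ki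
  proof -
    have "(\<lambda>\<omega>. \<omega> ki) \<in> measurable M (P ki)"
      unfolding M_def by (rule measurable_component_singleton) simp
    then show ?thesis by (simp add: measurable_def)
  qed
  have iv: "indep_vars P (\<lambda>ki \<omega>. \<omega> ki) UNIV"
  proof (subst indep_vars_iff_distr_eq_PiM')
    show "distr M (PiM UNIV P) (\<lambda>x. \<lambda>i\<in>UNIV. x i) = PiM UNIV (\<lambda>i. distr M (P i) (\<lambda>x. x i))"
      by (simp add: M_def comp restrict_UNIV distr_id)
  qed (auto simp: M_def intro!: measurable_component_singleton)
  have meas: "X k i \<in> measurable M (count_space UNIV)" for k i
    by (induction k) (auto simp: X0 XS[abs_def])
  have "detachment_process M n X"
  proof
    show "random_variable (count_space UNIV) (X k i)" for k i
      by (rule meas)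
    show "X 1 i \<omega> = 1" for i \<omega>
      by (simp add: XS)
    show "X k i \<omega> = k \<or> X k i \<omega> = X (k - 1) i \<omega>" if "k \<ge> 2" for k i \<omega>
      using that by (cases k) (auto simp: XS)
    show "\<P>(\<omega> in M. X k i \<omega> = k) = 1 / real k" if "k \<ge> 2" for k i
    proof -
      have "\<P>(\<omega> in M. X k i \<omega> = k) = measure (distr M (P (k, i)) (\<lambda>\<omega>. \<omega> (k, i))) {True}"
        using that by (subst measure_distr)
          (auto simp: reloc vimage_def M_def Int_def conj_commute
            intro!: measurable_component_singleton)
      also have "\<dots> = measure (P (k, i)) {True}"
        by (simp add: M_def comp)
      also have "\<dots> = 1 / real k"
        using that by (simp add: P_def measure_pmf_single)
      finally show ?thesis .
    qed
    have "indep_events (\<lambda>ki. {\<omega> \<in> space M. (\<lambda>ki. id) ki (\<omega> ki)}) ({2..} \<times> {1..n})"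
      by (rule indep_eventsI_indep_vars[OF indep_vars_subset[OF iv]]) auto
    also have "?this \<longleftrightarrow> indep_events (\<lambda>(k, i). {\<omega> \<in> space M. X k i \<omega> = k}) ({2..} \<times> {1..n})"
      unfolding indep_events_def_alt by (intro indep_sets_cong) (auto simp: reloc)
    finally show "indep_events (\<lambda>(k, i). {\<omega> \<in> space M. X k i \<omega> = k}) ({2..} \<times> {1..n})" .
  qed
  then show ?thesis by blast
qed

definition nonempty_buses :: "nat \<Rightarrow> (nat \<Rightarrow> nat \<Rightarrow> 'a \<Rightarrow> nat) \<Rightarrow> nat \<Rightarrow> 'a \<Rightarrow> nat set" where
  "nonempty_buses n X k \<omega> = {b. \<exists>i\<in>{1..n}. X k i \<omega> = b}"

definition min_bus :: "nat \<Rightarrow> (nat \<Rightarrow> nat \<Rightarrow> 'a \<Rightarrow> nat) \<Rightarrow> nat \<Rightarrow> 'a \<Rightarrow> nat" where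
  "min_bus n X k \<omega> = Min (nonempty_buses n X k \<omega>)"

definition max_bus :: "nat \<Rightarrow> (nat \<Rightarrow> nat \<Rightarrow> 'a \<Rightarrow> nat) \<Rightarrow> nat \<Rightarrow> 'a \<Rightarrow> nat" where
  "max_bus n X k \<omega> = Max (nonempty_buses n X k \<omega>)"

definition bus_range :: "nat \<Rightarrow> (nat \<Rightarrow> nat \<Rightarrow> 'a \<Rightarrow> nat) \<Rightarrow> nat \<Rightarrow> 'a \<Rightarrow> real" where
  "bus_range n X k \<omega> = real (max_bus n X k \<omega>) - real (min_bus n X k \<omega>)"

(* The open interval avoids the convention 0 powr 0 = 0 at the endpoints. *)
definition beta_density :: "real \<Rightarrow> real \<Rightarrow> real \<Rightarrow> real" where
  "beta_density a b x =
     (if x \<in> {0<..<1} then x powr (a - 1) * (1 - x) powr (b - 1) / Beta a b else 0)"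

definition beta_distribution :: "real \<Rightarrow> real \<Rightarrow> real measure" where
  "beta_distribution a b = density lborel (\<lambda>x. ennreal (beta_density a b x))"

definition std_dev :: "'a measure \<Rightarrow> ('a \<Rightarrow> real) \<Rightarrow> real" where
  "std_dev M Y = sqrt (prob_space.variance M Y)"

end

theory Submission
  imports Defs
begin

text \<open>
  Passenger \<open>i\<close> sits in one of the buses \<open>1, \<dots>, j\<close> at time \<open>k\<close> iff he never relocated at the times
  \<open>j + 1, \<dots>, k\<close>. The product of the factors \<open>1 - 1 / l\<close> telescopes to \<open>j / k\<close>, so the \<open>n\<close> positions are
  independent and uniform on \<open>{1..k}\<close>, and the minimum and maximum have the order-statistics
  probabilities \<open>1 - (1 - j / k) ^ n\<close> and \<open>(j / k) ^ n\<close>. With \<open>j = \<lfloor>x k\<rfloor>\<close> the distribution functions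
  converge to those of the Beta distributions. As the rescaled variables live in the unit interval,
  their moments are integrals of bounded continuous functions, so weak convergence also gives
  convergence of the means and standard deviations.
\<close>

section \<open>Beta distributions\<close>

lemma Beta_real_pos: "a > 0 \<Longrightarrow> b > 0 \<Longrightarrow> Beta a b > (0 :: real)"
  by (simp add: Beta_def)

lemma beta_density_nonneg: "a > 0 \<Longrightarrow> b > 0 \<Longrightarrow> beta_density a b x \<ge> 0"
  using Beta_real_pos[of a b] by (simp add: beta_density_def)

lemma measurable_beta_density [measurable]: "beta_density a b \<in> borel_measurable borel"
  unfolding beta_density_def[abs_def] by measurable

lemma space_beta_distribution [simp]: "space (beta_distribution a b) = UNIV"
  and sets_beta_distribution [simp, measurable_cong]: "sets (beta_distribution a b) = sets borel"
  by (simp_all add: beta_distribution_def)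

text \<open>A factor \<open>x ^ p\<close> raises the first Beta parameter by \<open>p\<close>, so
  the integral is a quotient of two Beta functions. The clamp \<open>max 0 (min 1 x)\<close> is the
  identity where the density lives; it keeps the integrand's power bounded and continuous on the
  whole line, as test functions for weak convergence must be.\<close>

lemma beta_density_moment_has_integral:
  fixes a b :: real
  assumes "a > 0" "b > 0"
  shows "((\<lambda>x. beta_density a b x * (max 0 (min 1 x)) ^ p) has_integral Beta (a + real p) b / Beta a b) UNIV"
proof -
  have "((\<lambda>t. t powr (a + real p - 1) * (1 - t) powr (b - 1) / Beta a b)
      has_integral Beta (a + real p) b / Beta a b) {0<..<1}"
    using has_integral_divide[OF has_integral_Beta_real[of "a + real p" b]] assms
    by (simp add: has_integral_Icc_iff_Ioo)
  also have "?this \<longleftrightarrow> ((\<lambda>x. beta_density a b x * (max 0 (min 1 x)) ^ p)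
      has_integral Beta (a + real p) b / Beta a b) {0<..<1}"
    by (intro has_integral_cong)
       (auto simp: beta_density_def powr_add powr_diff powr_realpow)
  also have "\<dots> \<longleftrightarrow> ?thesis"
    by (subst has_integral_restrict_UNIV[symmetric], intro has_integral_cong)
       (auto simp: beta_density_def)
  finally show ?thesis .
qed

lemma real_distribution_beta_distribution:
  assumes "a > 0" "b > 0"
  shows "real_distribution (beta_distribution a b)"
proof -
  have "Beta a b \<noteq> 0"
    using Beta_real_pos[OF assms] by simp
  then have "(\<integral>\<^sup>+x. beta_density a b x \<partial>lborel) = 1"
    \<comment> \<open>Total mass is the moment of order 0, where the quotient of Beta functions is
      1.\<close>
    using nn_integral_has_integral_lborel[of "beta_density a b" 1]
      beta_density_moment_has_integral[OF assms, of 0] by (simp add: beta_density_nonneg[OF assms])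
  then have "prob_space (beta_distribution a b)"
    by (intro prob_spaceI) (simp add: beta_distribution_def emeasure_density)
  then show ?thesis
    by (simp add: real_distribution_def real_distribution_axioms_def)
qed

lemma beta_distribution_moment:
  assumes "a > 0" "b > 0"
  shows "(\<integral>x. (max 0 (min 1 x)) ^ p \<partial>beta_distribution a b) = Beta (a + real p) b / Beta a b"
proof -
  have nonneg: "0 \<le> beta_density a b x * (max 0 (min 1 x)) ^ p" for x
    using beta_density_nonneg[OF assms] by simp
  have "0 \<le> Beta (a + real p) b / Beta a b"
    by (rule has_integral_nonneg[OF beta_density_moment_has_integral[OF assms] nonneg])
  moreover have "(\<integral>\<^sup>+x. beta_density a b x * (max 0 (min 1 x)) ^ p \<partial>lborel) =
      Beta (a + real p) b / Beta a b"
    by (rule nn_integral_has_integral_lborel[OF _ nonneg beta_density_moment_has_integral[OF assms]]) simp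
  ultimately have "(\<integral>x. beta_density a b x * (max 0 (min 1 x)) ^ p \<partial>lborel) =
      Beta (a + real p) b / Beta a b"
    using nonneg by (subst integral_eq_nn_integral) auto
  then show ?thesis
    using beta_density_nonneg[OF assms] unfolding beta_distribution_def
    by (subst integral_density) auto
qed

lemma beta_distribution_first_moment:
  assumes "a > 0" "b > 0"
  shows "(\<integral>x. max 0 (min 1 x) \<partial>beta_distribution a b) = a / (a + b)"
proof -
  have "Beta a b \<noteq> 0"
    using Beta_real_pos[OF assms] by simp
  moreover have "(a + b) * Beta (a + 1) b = a * Beta a b"
    using assms by (intro Beta_plus1_left) (auto simp: elim!: nonpos_Ints_cases)
  ultimately have "Beta (a + 1) b / Beta a b = a / (a + b)"
    using assms by (subst frac_eq_eq) (auto simp: mult.commute)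
  then show ?thesis
    using beta_distribution_moment[OF assms, of 1] by simp
qed

text \<open>The recurrence \<open>(a + b) * Beta (a + 1) b = a * Beta a b\<close>, applied at
  \<open>a\<close> and again at \<open>a + 1\<close>, reduces the quotient of Beta functions to a
  rational one.\<close>

lemma beta_distribution_second_moment:
  assumes "a > 0" "b > 0"
  shows "(\<integral>x. (max 0 (min 1 x))\<^sup>2 \<partial>beta_distribution a b) = a * (a + 1) / ((a + b) * (a + b + 1))"
proof -
  have nz: "Beta a b \<noteq> 0"
    using Beta_real_pos[OF assms] by simp
  have "(a + b) * Beta (a + 1) b = a * Beta a b"
    using assms by (intro Beta_plus1_left) (auto simp: elim!: nonpos_Ints_cases)
  moreover have "(a + 1 + b) * Beta (a + 1 + 1) b = (a + 1) * Beta (a + 1) b"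
    using assms by (intro Beta_plus1_left) (auto simp: elim!: nonpos_Ints_cases)
  moreover have "a + real 2 = a + 1 + 1" by simp
  ultimately have "((a + b) * (a + b + 1)) * Beta (a + real 2) b = a * (a + 1) * Beta a b"
    by (metis (no_types, opaque_lifting) mult.assoc mult.commute add.commute add.left_commute)
  then have "Beta (a + real 2) b / Beta a b = a * (a + 1) / ((a + b) * (a + b + 1))"
    using assms nz by (subst frac_eq_eq) (auto simp: mult.commute)
  then show ?thesis
    using beta_distribution_moment[OF assms, of 2] by simp
qed

section \<open>Distribution functions of the Beta laws\<close>

lemma cdf_beta_distribution:
  assumes "a > 0" "b > 0"
    and cont: "continuous_on {0..1} F" and F0: "F 0 = 0"
    and deriv: "\<And>t. 0 < t \<Longrightarrow> t < 1 \<Longrightarrow> (F has_real_derivative beta_density a b t) (at t)"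
  shows "cdf (beta_distribution a b) x = F (max 0 (min 1 x))"
proof -
  define c where "c = max 0 (min 1 x)"
  have c: "0 \<le> c" "c \<le> 1" by (auto simp: c_def)
  have nonneg: "0 \<le> beta_density a b t * indicator {..x} t" for t
    using beta_density_nonneg[OF assms(1,2)] by simp
  \<comment> \<open>Only interior derivatives enter: \<open>beta_density\<close> is set to 0 at the
    endpoints, where the derivative of \<open>F\<close> may be different. Continuity of
    \<open>F\<close> covers the endpoints.\<close>
  have "(beta_density a b has_integral F c - F 0) {0..c}"
    using c deriv cont
    by (intro fundamental_theorem_of_calculus_interior)
       (auto simp: has_real_derivative_iff_has_vector_derivative intro: continuous_on_subset)
  then have "((\<lambda>t. if t \<in> {0<..<c} then beta_density a b t else 0) has_integral F c) UNIV"
    by (simp only: has_integral_restrict_UNIV has_integral_Icc_iff_Ioo F0 diff_zero)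
  \<comment> \<open>The two integrands can differ only at \<open>c\<close>: for \<open>x\<close>
    inside the unit interval, \<open>c = x\<close> belongs to \<open>{..x}\<close> but not to
    \<open>{0<..<c}\<close>. Elsewhere the density vanishes off the open unit interval.\<close>
  then have int: "((\<lambda>t. beta_density a b t * indicator {..x} t) has_integral F c) UNIV"
    by (rule has_integral_spike_finite[of "{c}", rotated 2])
       (auto simp: c_def beta_density_def split: split_indicator)
  have "F c \<ge> 0"
    by (rule has_integral_nonneg[OF int nonneg])
  have "emeasure (beta_distribution a b) {..x} = (\<integral>\<^sup>+t. beta_density a b t * indicator {..x} t \<partial>lborel)"
    using beta_density_nonneg[OF assms(1,2)]
    by (simp add: beta_distribution_def emeasure_density ennreal_mult ennreal_indicator)
  also have "\<dots> = F c"
    by (rule nn_integral_has_integral_lborel[OF _ nonneg int]) simp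
  finally show ?thesis
    using \<open>F c \<ge> 0\<close> by (simp add: cdf_def measure_def c_def)
qed

text \<open>With this normalization the two densities used below become
  \<open>n * (1 - t) ^ (n - 1)\<close> and \<open>n * t ^ (n - 1)\<close> on the open unit interval,
  the derivatives of elementary distribution functions.\<close>

lemma Beta_1_right: "a > 0 \<Longrightarrow> Beta a 1 = 1 / (a :: real)"
  using Gamma_plus1[of a] Gamma_real_pos[of a]
  by (cases "a \<in> \<int>\<^sub>\<le>\<^sub>0") (auto simp: Beta_def elim!: nonpos_Ints_cases simp del: Gamma_real_pos)

lemma cdf_beta_distribution_1_n:
  assumes "n \<ge> 1"
  shows "cdf (beta_distribution 1 (real n)) x = 1 - (1 - max 0 (min 1 x)) ^ n"
proof (rule cdf_beta_distribution)
  fix t :: real assume "0 < t" "t < 1"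
  then show "((\<lambda>t. 1 - (1 - t) ^ n) has_real_derivative beta_density 1 (real n) t) (at t)"
    using assms powr_realpow[of "1 - t" "n - 1"] Beta_1_right[of "real n"]
    by (auto intro!: derivative_eq_intros simp: beta_density_def Beta_commute[of 1] of_nat_diff)
qed (use assms in \<open>auto intro!: continuous_intros\<close>)

lemma cdf_beta_distribution_n_1:
  assumes "n \<ge> 1"
  shows "cdf (beta_distribution (real n) 1) x = (max 0 (min 1 x)) ^ n"
proof (rule cdf_beta_distribution)
  fix t :: real assume "0 < t" "t < 1"
  then show "((\<lambda>t. t ^ n) has_real_derivative beta_density (real n) 1 t) (at t)"
    using assms powr_realpow[of t "n - 1"] Beta_1_right[of "real n"]
    by (auto intro!: derivative_eq_intros simp: beta_density_def of_nat_diff)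
qed (use assms in \<open>auto intro!: continuous_intros\<close>)

section \<open>Weak convergence on the unit interval\<close>

context prob_space
begin

text \<open>Convergence of distribution functions on the unit interval extends to every real
  \<open>x\<close>, because outside the interval both sides agree with their values at the clamped
  argument or vanish.\<close>

lemma weak_conv_m_unit_interval:
  fixes Y :: "nat \<Rightarrow> 'a \<Rightarrow> real"
  assumes [measurable]: "\<And>k. random_variable borel (Y k)"
    and Y01: "\<And>k \<omega>. \<omega> \<in> space M \<Longrightarrow> Y k \<omega> \<in> {0..1}"
    and conv: "\<And>x. x \<in> {0..1} \<Longrightarrow> (\<lambda>k. \<P>(\<omega> in M. Y k \<omega> \<le> x)) \<longlonglongrightarrow> F x"
    and cdf: "\<And>x. cdf \<mu> x = F (max 0 (min 1 x))" and F0: "F 0 = 0"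
  shows "weak_conv_m (\<lambda>k. distr M borel (Y k)) \<mu>"
  unfolding weak_conv_m_def weak_conv_def
proof (intro allI impI)
  fix x
  have eq: "cdf (distr M borel (Y k)) x = \<P>(\<omega> in M. Y k \<omega> \<le> x)" for k
    by (auto simp: cdf_def measure_distr intro!: arg_cong[where f = prob])
  show "(\<lambda>k. cdf (distr M borel (Y k)) x) \<longlonglongrightarrow> cdf \<mu> x"
  proof (cases "x < 0")
    case True
    have empty: "{\<omega> \<in> space M. Y k \<omega> \<le> x} = {}" for k
      using True Y01[of _ k] by force
    show ?thesis unfolding eq empty using True F0 by (simp add: cdf)
  next
    case False
    then have "{\<omega> \<in> space M. Y k \<omega> \<le> x} = {\<omega> \<in> space M. Y k \<omega> \<le> max 0 (min 1 x)}" for k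
      using Y01[of _ k] by force
    then show ?thesis using conv[of "max 0 (min 1 x)"] by (simp only: eq cdf) auto
  qed
qed

text \<open>Clamping does not change \<open>Y k\<close>, and the clamped power is continuous and
  bounded by 1, hence an admissible test function for weak convergence.\<close>

lemma unit_interval_moment_tendsto:
  fixes Y :: "nat \<Rightarrow> 'a \<Rightarrow> real"
  assumes [measurable]: "\<And>k. random_variable borel (Y k)"
    and Y01: "\<And>k \<omega>. \<omega> \<in> space M \<Longrightarrow> Y k \<omega> \<in> {0..1}"
    and "weak_conv_m (\<lambda>k. distr M borel (Y k)) \<mu>" "real_distribution \<mu>"
  shows "(\<lambda>k. expectation (\<lambda>\<omega>. Y k \<omega> ^ p)) \<longlonglongrightarrow> (\<integral>x. (max 0 (min 1 x)) ^ p \<partial>\<mu>)"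
proof -
  have "(\<lambda>k. \<integral>x. (max 0 (min 1 x)) ^ p \<partial>distr M borel (Y k)) \<longlonglongrightarrow> (\<integral>x. (max 0 (min 1 x)) ^ p \<partial>\<mu>)"
    using assms(3,4)
    by (intro weak_conv_imp_integral_bdd_continuous_conv[where B = 1])
       (auto simp: power_le_one intro!: continuous_intros)
  moreover have "(\<integral>x. (max 0 (min 1 x)) ^ p \<partial>distr M borel (Y k)) = expectation (\<lambda>\<omega>. Y k \<omega> ^ p)" for k
    using Y01[of _ k] by (subst integral_distr) (auto intro!: Bochner_Integration.integral_cong)
  ultimately show ?thesis by simp
qed

lemma beta_expectation_tendsto:
  fixes Y :: "nat \<Rightarrow> 'a \<Rightarrow> real"
  assumes "a > 0" "b > 0"
    and "\<And>k. random_variable borel (Y k)"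
    and "\<And>k \<omega>. \<omega> \<in> space M \<Longrightarrow> Y k \<omega> \<in> {0..1}"
    and "weak_conv_m (\<lambda>k. distr M borel (Y k)) (beta_distribution a b)"
  shows "(\<lambda>k. expectation (Y k)) \<longlonglongrightarrow> a / (a + b)"
  using unit_interval_moment_tendsto[OF assms(3-5) real_distribution_beta_distribution[OF assms(1,2)], of 1]
    beta_distribution_first_moment[OF assms(1,2)] by simp

lemma beta_std_dev_tendsto:
  fixes Y :: "nat \<Rightarrow> 'a \<Rightarrow> real"
  assumes ab: "a > 0" "b > 0"
    and Y [measurable]: "\<And>k. random_variable borel (Y k)"
    and Y01: "\<And>k \<omega>. \<omega> \<in> space M \<Longrightarrow> Y k \<omega> \<in> {0..1}"
    and conv: "weak_conv_m (\<lambda>k. distr M borel (Y k)) (beta_distribution a b)"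
  shows "(\<lambda>k. std_dev M (Y k)) \<longlonglongrightarrow> 1 / (a + b) * sqrt (a * b / (a + b + 1))"
proof -
  have "variance (Y k) = expectation (\<lambda>\<omega>. Y k \<omega> ^ 2) - (expectation (Y k))\<^sup>2" for k
  proof (rule variance_eq)
    show "integrable M (Y k)"
      using Y01 by (intro integrable_const_bound[where B = 1]) auto
    show "integrable M (\<lambda>\<omega>. (Y k \<omega>)\<^sup>2)"
      using Y01 by (intro integrable_const_bound[where B = 1]) (auto simp: power_le_one)
  qed
  moreover have "(\<lambda>k. sqrt (expectation (\<lambda>\<omega>. Y k \<omega> ^ 2) - (expectation (Y k))\<^sup>2)) \<longlonglongrightarrow>
      sqrt (a * (a + 1) / ((a + b) * (a + b + 1)) - (a / (a + b))\<^sup>2)"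
    using unit_interval_moment_tendsto[OF Y Y01 conv real_distribution_beta_distribution[OF ab], of 2]
      beta_expectation_tendsto[OF ab Y Y01 conv]
    by (auto simp: beta_distribution_second_moment[OF ab] intro!: tendsto_intros)
  moreover have "a * (a + 1) / ((a + b) * (a + b + 1)) - (a / (a + b))\<^sup>2 =
      (1 / (a + b))\<^sup>2 * (a * b / (a + b + 1))"
  proof -
    have nz: "a + b \<noteq> 0" "a + b + 1 \<noteq> 0" using ab by auto
    \<comment> \<open>Here \<open>s\<close> stands for \<open>a + b\<close>, so that
      \<open>b\<close> becomes \<open>s - a\<close> and the denominators are single
      variables.\<close>
    have "a * (a + 1) / (s * (s + 1)) - (a / s)\<^sup>2 = (1 / s)\<^sup>2 * (a * (s - a) / (s + 1))"
      if "s \<noteq> 0" "s + 1 \<noteq> 0" for s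
      using that by (simp add: divide_simps power2_eq_square) (simp add: algebra_simps)
    from this[OF nz] show ?thesis by simp
  qed
  ultimately show ?thesis
    using ab by (simp add: std_dev_def real_sqrt_mult real_sqrt_divide)
qed

section \<open>Independent events and their complements\<close>

lemma indep_events_prob_INT:
  assumes "indep_events A I" "J \<subseteq> I" "J \<noteq> {}" "finite J"
  shows "prob (\<Inter>j\<in>J. A j) = (\<Prod>j\<in>J. prob (A j))"
  using assms unfolding indep_events_def by auto

text \<open>The singleton family \<open>{A i}\<close> is stable under intersection, so the sigma
  algebras it generates are independent too, and these contain the complements.\<close>

lemma indep_events_Compl:
  assumes "indep_events A I"
  shows "indep_events (\<lambda>i. space M - A i) I"
proof -
  have "indep_sets (\<lambda>i. sigma_sets (space M) {A i}) I"
    using assms by (intro indep_sets_sigma) (auto simp: indep_events_def_alt Int_stable_def)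
  then show ?thesis
    unfolding indep_events_def_alt
    by (rule indep_sets_mono_sets) (auto intro: sigma_sets.intros)
qed

end

section \<open>The extreme buses\<close>

lemma prod_one_minus_inverse:
  assumes "1 \<le> j" "j \<le> k"
  shows "(\<Prod>l\<in>{j<..k}. 1 - 1 / real l) = real j / real k"
  using assms(2)
proof (induction k rule: dec_induct)
  case base
  then show ?case using assms by simp
next
  case (step k)
  have "{j<..Suc k} = insert (Suc k) {j<..k}" using step by auto
  then show ?case using step assms by (simp add: field_simps)
qed

lemma nat_floor_ratio_tendsto:
  fixes x :: real
  assumes "0 \<le> x"
  shows "(\<lambda>k. real (nat \<lfloor>x * real k\<rfloor>) / real k) \<longlonglongrightarrow> x"
proof (rule real_tendsto_sandwich)
  show "(\<lambda>k. x - 1 / real k) \<longlonglongrightarrow> x"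
    using tendsto_diff[OF tendsto_const lim_1_over_n] by simp
  show "\<forall>\<^sub>F k in sequentially. x - 1 / real k \<le> real (nat \<lfloor>x * real k\<rfloor>) / real k"
    using eventually_gt_at_top[of 0]
  proof eventually_elim
    case (elim k)
    have "x * real k - 1 \<le> real (nat \<lfloor>x * real k\<rfloor>)"
      using assms by simp
    then have "(x * real k - 1) / real k \<le> real (nat \<lfloor>x * real k\<rfloor>) / real k"
      by (intro divide_right_mono) auto
    then show ?case using elim by (simp add: diff_divide_distrib)
  qed
  show "\<forall>\<^sub>F k in sequentially. real (nat \<lfloor>x * real k\<rfloor>) / real k \<le> x"
    using eventually_gt_at_top[of 0]
    by eventually_elim (use assms in \<open>simp add: field_simps\<close>)
qed simp

context detachment_process
begin

section \<open>Joint law of the passengers' positions\<close>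

lemma bus_bounds:
  assumes "k \<ge> 1" "i \<in> {1..n}" "\<omega> \<in> space M"
  shows "1 \<le> X k i \<omega>" "X k i \<omega> \<le> k"
proof -
  have "1 \<le> X k i \<omega> \<and> X k i \<omega> \<le> k"
    using assms(1)
  proof (induction k rule: dec_induct)
    case base
    then show ?case using start assms by simp
  next
    case (step k)
    then show ?case
      using detachment_process.step[OF detachment_process_axioms, of "Suc k" i \<omega>] assms by auto
  qed
  then show "1 \<le> X k i \<omega>" "X k i \<omega> \<le> k" by auto
qed

text \<open>A relocation at time \<open>l > j\<close> leads to a bus beyond \<open>j\<close>, and
  later relocations only increase the number. Without one, the passenger keeps the bus held at time
  \<open>j\<close>, which is at most \<open>j\<close>.\<close>

lemma bus_le_iff:
  assumes "1 \<le> j" "j \<le> k" "i \<in> {1..n}" "\<omega> \<in> space M"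
  shows "X k i \<omega> \<le> j \<longleftrightarrow> (\<forall>l\<in>{j<..k}. X l i \<omega> \<noteq> l)"
  using assms(2)
proof (induction k rule: dec_induct)
  case base
  then show ?case using bus_bounds assms by simp
next
  case (step k)
  have "{j<..Suc k} = insert (Suc k) {j<..k}" using step by auto
  moreover have "X k i \<omega> \<le> k" using step assms by (intro bus_bounds) auto
  moreover have "X (Suc k) i \<omega> = Suc k \<or> X (Suc k) i \<omega> = X k i \<omega>"
    using detachment_process.step[OF detachment_process_axioms, of "Suc k" i \<omega>] step assms by auto
  ultimately show ?case using step by auto
qed

lemma measurable_bus [measurable]:
  assumes "k \<ge> 1" "i \<in> {1..n}"
  shows "{\<omega> \<in> space M. X k i \<omega> \<le> j} \<in> events"
  using rv[OF assms] by measurable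

text \<open>Arbitrary sets \<open>J\<close> of passengers serve three purposes: singletons give the
  marginal laws, all subsets together give independence across passengers, and the full set gives
  the law of the maximum.\<close>

lemma prob_all_bus_le:
  assumes "k \<ge> 1" "j \<le> k" "J \<subseteq> {1..n}"
  shows "\<P>(\<omega> in M. \<forall>i\<in>J. X k i \<omega> \<le> j) = (real j / real k) ^ card J"
proof -
  have fin: "finite J" using assms(3) finite_subset by blast
  \<comment> \<open>The product formula for independent events requires a nonempty index set, which
    fails for \<open>J = {}\<close> and for \<open>j = k\<close>. The value \<open>j = 0\<close> is
    separate because \<open>bus_le_iff\<close> starts at \<open>j = 1\<close>.\<close>
  consider "J = {}" | "J \<noteq> {}" "j = 0" | "j = k" | "J \<noteq> {}" "1 \<le> j" "j < k"
    using assms by linarith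
  then show ?thesis
  proof cases
    case 1
    then show ?thesis by (simp add: prob_space)
  next
    case 2
    then have empty: "{\<omega> \<in> space M. \<forall>i\<in>J. X k i \<omega> \<le> j} = {}"
      using bus_bounds(1)[OF assms(1)] assms(3) by fastforce
    show ?thesis unfolding empty using 2 fin by (simp add: card_gt_0_iff)
  next
    case 3
    then have "{\<omega> \<in> space M. \<forall>i\<in>J. X k i \<omega> \<le> j} = space M"
      using bus_bounds(2)[OF assms(1)] assms(3) by blast
    then show ?thesis using 3 assms by (simp add: prob_space)
  next
    case 4
    let ?A = "\<lambda>(l, i). {\<omega> \<in> space M. X l i \<omega> = l}"
    let ?I = "{j<..k} \<times> J"
    \<comment> \<open>Since \<open>j\<close> is at least 1, all times in \<open>{j<..k}\<close> are
      at least 2, where relocation events are governed by the independence assumption.\<close>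
    have sub: "?I \<subseteq> {2..} \<times> {1..n}" "?I \<noteq> {}" "finite ?I" using 4 assms fin by auto
    have ev: "?A li \<in> events" if "li \<in> ?I" for li
      using indep_relocate subsetD[OF sub(1) that] unfolding indep_events_def by (auto simp: image_subset_iff)
    have "(\<forall>i\<in>J. X k i \<omega> \<le> j) \<longleftrightarrow> (\<forall>i\<in>J. \<forall>l\<in>{j<..k}. X l i \<omega> \<noteq> l)" if "\<omega> \<in> space M" for \<omega>
      using bus_le_iff[of j k _ \<omega>] that 4 assms by (intro ball_cong refl) auto
    then have "{\<omega> \<in> space M. \<forall>i\<in>J. X k i \<omega> \<le> j} = {\<omega> \<in> space M. \<forall>i\<in>J. \<forall>l\<in>{j<..k}. X l i \<omega> \<noteq> l}"
      by blast
    \<comment> \<open>Nonemptiness of \<open>?I\<close> keeps the intersection inside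
      \<open>space M\<close>; an empty one would be the whole type.\<close>
    also have "\<dots> = (\<Inter>li\<in>?I. space M - ?A li)"
      using sub(2) by fastforce
    also have "prob \<dots> = (\<Prod>li\<in>?I. prob (space M - ?A li))"
      by (rule indep_events_prob_INT[OF indep_events_Compl[OF indep_relocate] sub])
    also have "\<dots> = (\<Prod>(l, i)\<in>?I. 1 - 1 / real l)"
    proof (rule prod.cong[OF refl])
      fix li assume li: "li \<in> ?I"
      then have "prob (?A li) = 1 / real (fst li)"
        using prob_relocate[of "fst li" "snd li"] subsetD[OF sub(1) li] by (auto simp: case_prod_beta)
      then show "prob (space M - ?A li) = (case li of (l, i) \<Rightarrow> 1 - 1 / real l)"
        using prob_compl[OF ev[OF li]] by (simp add: case_prod_beta)
    qed
    \<comment> \<open>The factors do not depend on the passenger, so each passenger in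
      \<open>J\<close> contributes the same telescoping product.\<close>
    also have "\<dots> = (\<Prod>l\<in>{j<..k}. 1 - 1 / real l) ^ card J"
      by (simp add: prod.cartesian_product[symmetric] prod_power_distrib)
    finally show ?thesis using prod_one_minus_inverse[of j k] 4 by simp
  qed
qed

lemma prob_all_bus_gt:
  assumes "k \<ge> 1" "j \<le> k" "n \<ge> 1"
  shows "\<P>(\<omega> in M. \<forall>i\<in>{1..n}. j < X k i \<omega>) = (1 - real j / real k) ^ n"
proof -
  let ?B = "\<lambda>i. {\<omega> \<in> space M. X k i \<omega> \<le> j}"
  have prob_B: "prob (?B i) = real j / real k" if "i \<in> {1..n}" for i
    using prob_all_bus_le[OF assms(1,2), of "{i}"] that by simp
  \<comment> \<open>The product formula of \<open>prob_all_bus_le\<close> for every \<open>J\<close>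
    is exactly independence of the events \<open>?B i\<close>; passing to complements then gives the
    strict lower bounds.\<close>
  have "indep_events ?B {1..n}"
  proof (rule indep_eventsI)
    fix J assume J: "J \<subseteq> {1..n}" "finite J" "J \<noteq> {}"
    then have "(\<Inter>i\<in>J. ?B i) = {\<omega> \<in> space M. \<forall>i\<in>J. X k i \<omega> \<le> j}" by auto
    also have "prob \<dots> = (\<Prod>i\<in>J. real j / real k)"
      using prob_all_bus_le[OF assms(1,2) J(1)] by simp
    also have "\<dots> = (\<Prod>i\<in>J. prob (?B i))"
      using J prob_B by (intro prod.cong) auto
    finally show "prob (\<Inter>i\<in>J. ?B i) = (\<Prod>i\<in>J. prob (?B i))" .
  qed (use assms measurable_bus in auto)
  then have "prob (\<Inter>i\<in>{1..n}. space M - ?B i) = (\<Prod>i\<in>{1..n}. prob (space M - ?B i))"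
    using assms(3) by (intro indep_events_prob_INT[OF indep_events_Compl]) auto
  also have "\<dots> = (\<Prod>i\<in>{1..n}. 1 - real j / real k)"
    using prob_B assms measurable_bus by (intro prod.cong) (auto simp: prob_compl)
  also have "(\<Inter>i\<in>{1..n}. space M - ?B i) = {\<omega> \<in> space M. \<forall>i\<in>{1..n}. j < X k i \<omega>}"
    using assms(3) by (auto simp: not_le)
  finally show ?thesis by simp
qed

section \<open>From positions to the smallest and largest bus\<close>

lemma nonempty_buses_eq_image: "nonempty_buses n X k \<omega> = (\<lambda>i. X k i \<omega>) ` {1..n}"
  by (auto simp: nonempty_buses_def)

lemma max_bus_le_iff: "n \<ge> 1 \<Longrightarrow> max_bus n X k \<omega> \<le> j \<longleftrightarrow> (\<forall>i\<in>{1..n}. X k i \<omega> \<le> j)"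
  by (simp add: max_bus_def nonempty_buses_eq_image Max_le_iff)

lemma min_bus_gt_iff: "n \<ge> 1 \<Longrightarrow> j < min_bus n X k \<omega> \<longleftrightarrow> (\<forall>i\<in>{1..n}. j < X k i \<omega>)"
  by (simp add: min_bus_def nonempty_buses_eq_image Min_gr_iff)

text \<open>The weak convergence lemmas speak of all indices, including \<open>k = 0\<close>, where
  \<open>rv\<close> gives no information. There division by zero makes the ratio the constant 0,
  which is measurable and lies in the unit interval.\<close>

lemma measurable_bus_ratio:
  shows "random_variable borel (\<lambda>\<omega>. real (min_bus n X k \<omega>) / real k)"
    and "random_variable borel (\<lambda>\<omega>. real (max_bus n X k \<omega>) / real k)"
proof -
  have [measurable]: "Measurable.pred M (\<lambda>\<omega>. \<exists>i\<in>{1..n}. X k i \<omega> = b)" if "k \<ge> 1" for b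
    using rv[OF that] by measurable
  have "random_variable (count_space UNIV) (min_bus n X k)" "random_variable (count_space UNIV) (max_bus n X k)"
    if "k \<ge> 1"
    unfolding min_bus_def[abs_def] max_bus_def[abs_def] nonempty_buses_def using that by measurable
  then show "random_variable borel (\<lambda>\<omega>. real (min_bus n X k \<omega>) / real k)"
    "random_variable borel (\<lambda>\<omega>. real (max_bus n X k \<omega>) / real k)"
    by (cases "k = 0"; force)+
qed

lemma bus_ratio_bounds:
  assumes "n \<ge> 1" "\<omega> \<in> space M"
  shows "real (min_bus n X k \<omega>) / real k \<in> {0..1}" "real (max_bus n X k \<omega>) / real k \<in> {0..1}"
proof -
  have "min_bus n X k \<omega> \<le> k" "max_bus n X k \<omega> \<le> k" if "k \<ge> 1"
    using max_bus_le_iff[OF assms(1), of k \<omega> k] min_bus_gt_iff[OF assms(1), of k k \<omega>]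
      bus_bounds(2)[OF that _ assms(2)] assms(1) by (force simp: not_less[symmetric])+
  then show "real (min_bus n X k \<omega>) / real k \<in> {0..1}" "real (max_bus n X k \<omega>) / real k \<in> {0..1}"
    by (cases "k = 0"; force simp: divide_le_eq)+
qed

lemma prob_max_bus_tendsto:
  assumes "n \<ge> 1" "x \<in> {0..1}"
  shows "(\<lambda>k. \<P>(\<omega> in M. real (max_bus n X k \<omega>) / real k \<le> x)) \<longlonglongrightarrow> x ^ n"
proof (rule Lim_transform_eventually)
  show "(\<lambda>k. (real (nat \<lfloor>x * real k\<rfloor>) / real k) ^ n) \<longlonglongrightarrow> x ^ n"
    using assms by (intro tendsto_power nat_floor_ratio_tendsto) auto
  show "\<forall>\<^sub>F k in sequentially. (real (nat \<lfloor>x * real k\<rfloor>) / real k) ^ n =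
      \<P>(\<omega> in M. real (max_bus n X k \<omega>) / real k \<le> x)"
    using eventually_ge_at_top[of 1]
  proof eventually_elim
    case (elim k)
    \<comment> \<open>Bus numbers are integers, so comparing with \<open>x * real k\<close> amounts
      to comparing with its floor.\<close>
    have "real (max_bus n X k \<omega>) / real k \<le> x \<longleftrightarrow> max_bus n X k \<omega> \<le> nat \<lfloor>x * real k\<rfloor>" for \<omega>
      using elim assms by (simp add: le_nat_iff le_floor_iff divide_le_eq)
    then have "real (max_bus n X k \<omega>) / real k \<le> x \<longleftrightarrow> (\<forall>i\<in>{1..n}. X k i \<omega> \<le> nat \<lfloor>x * real k\<rfloor>)" for \<omega>
      using max_bus_le_iff[OF assms(1)] by simp
    \<comment> \<open>This uses \<open>x\<close> at most 1 and puts the floor in the range covered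
      by \<open>prob_all_bus_le\<close>.\<close>
    moreover have "nat \<lfloor>x * real k\<rfloor> \<le> k"
      using elim assms by (simp add: nat_le_iff floor_le_iff mult_left_le_one_le le_less_trans[of _ "real k"])
    ultimately show ?case
      using prob_all_bus_le[OF elim, of _ "{1..n}"] by simp
  qed
qed

text \<open>The complementary event is the one that factors: the minimum exceeds a level iff every
  passenger does.\<close>

lemma prob_min_bus_tendsto:
  assumes "n \<ge> 1" "x \<in> {0..1}"
  shows "(\<lambda>k. \<P>(\<omega> in M. real (min_bus n X k \<omega>) / real k \<le> x)) \<longlonglongrightarrow> 1 - (1 - x) ^ n"
proof (rule Lim_transform_eventually)
  show "(\<lambda>k. 1 - (1 - real (nat \<lfloor>x * real k\<rfloor>) / real k) ^ n) \<longlonglongrightarrow> 1 - (1 - x) ^ n"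
    using assms by (intro tendsto_intros nat_floor_ratio_tendsto) auto
  show "\<forall>\<^sub>F k in sequentially. 1 - (1 - real (nat \<lfloor>x * real k\<rfloor>) / real k) ^ n =
      \<P>(\<omega> in M. real (min_bus n X k \<omega>) / real k \<le> x)"
    using eventually_ge_at_top[of 1]
  proof eventually_elim
    case (elim k)
    note [measurable] = measurable_bus_ratio(1)[of k]
    have "\<not> real (min_bus n X k \<omega>) / real k \<le> x \<longleftrightarrow> nat \<lfloor>x * real k\<rfloor> < min_bus n X k \<omega>" for \<omega>
      using elim assms by (simp add: not_le[symmetric] le_nat_iff le_floor_iff divide_le_eq)
    then have "\<not> real (min_bus n X k \<omega>) / real k \<le> x \<longleftrightarrow> (\<forall>i\<in>{1..n}. nat \<lfloor>x * real k\<rfloor> < X k i \<omega>)" for \<omega>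
      using min_bus_gt_iff[OF assms(1)] by simp
    moreover have "nat \<lfloor>x * real k\<rfloor> \<le> k"
      using elim assms by (simp add: nat_le_iff floor_le_iff mult_left_le_one_le le_less_trans[of _ "real k"])
    ultimately have "\<P>(\<omega> in M. \<not> real (min_bus n X k \<omega>) / real k \<le> x) =
        (1 - real (nat \<lfloor>x * real k\<rfloor>) / real k) ^ n"
      using prob_all_bus_gt[OF elim _ assms(1)] by simp
    then show ?case
      using prob_neg[of "\<lambda>\<omega>. real (min_bus n X k \<omega>) / real k \<le> x"] by simp
  qed
qed

end

theorem theorem2p7:
  fixes M :: "'a measure" and n :: nat and X :: "nat \<Rightarrow> nat \<Rightarrow> 'a \<Rightarrow> nat"
  assumes "n \<ge> 1" and "detachment_process M n X"
  defines "m \<equiv> min_bus n X" and "MM \<equiv> max_bus n X" and "R \<equiv> bus_range n X"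
  shows
    "weak_conv_m (\<lambda>k. distr M borel (\<lambda>\<omega>. real (m k \<omega>) / real k)) (beta_distribution 1 (real n)) \<and>
     weak_conv_m (\<lambda>k. distr M borel (\<lambda>\<omega>. real (MM k \<omega>) / real k)) (beta_distribution (real n) 1) \<and>
     (\<forall>x\<in>{0..1}. (\<lambda>k. \<P>(\<omega> in M. real (m k \<omega>) / real k \<le> x)) \<longlonglongrightarrow> 1 - (1 - x) ^ n) \<and>
     (\<forall>x\<in>{0..1}. (\<lambda>k. \<P>(\<omega> in M. real (MM k \<omega>) / real k \<le> x)) \<longlonglongrightarrow> x ^ n) \<and>
     (\<lambda>k. prob_space.expectation M (\<lambda>\<omega>. real (m k \<omega>) / real k)) \<longlonglongrightarrow> 1 / (real n + 1) \<and>
     (\<lambda>k. prob_space.expectation M (\<lambda>\<omega>. real (MM k \<omega>) / real k)) \<longlonglongrightarrow> real n / (real n + 1) \<and>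
     (\<lambda>k. prob_space.expectation M (\<lambda>\<omega>. R k \<omega> / real k))
        \<longlonglongrightarrow> (real n - 1) / (real n + 1) \<and>
     (\<lambda>k. std_dev M (\<lambda>\<omega>. real (MM k \<omega>) / real k))
        \<longlonglongrightarrow> 1 / (real n + 1) * sqrt (real n / (real n + 2)) \<and>
     (\<lambda>k. std_dev M (\<lambda>\<omega>. real (m k \<omega>) / real k))
        \<longlonglongrightarrow> 1 / (real n + 1) * sqrt (real n / (real n + 2))"
proof -
  interpret detachment_process M n X by fact
  have n: "real n > 0" using assms(1) by simp
  note m = measurable_bus_ratio(1) bus_ratio_bounds(1)[OF assms(1)]
  note MM = measurable_bus_ratio(2) bus_ratio_bounds(2)[OF assms(1)]
  have wm: "weak_conv_m (\<lambda>k. distr M borel (\<lambda>\<omega>. real (min_bus n X k \<omega>) / real k)) (beta_distribution 1 (real n))"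
    using assms(1)
    by (intro weak_conv_m_unit_interval[OF m prob_min_bus_tendsto cdf_beta_distribution_1_n]) auto
  have wM: "weak_conv_m (\<lambda>k. distr M borel (\<lambda>\<omega>. real (max_bus n X k \<omega>) / real k)) (beta_distribution (real n) 1)"
    using assms(1)
    by (intro weak_conv_m_unit_interval[OF MM prob_max_bus_tendsto cdf_beta_distribution_n_1]) auto
  have em: "(\<lambda>k. expectation (\<lambda>\<omega>. real (min_bus n X k \<omega>) / real k)) \<longlonglongrightarrow> 1 / (1 + real n)"
    using n by (intro beta_expectation_tendsto m wm) auto
  have eM: "(\<lambda>k. expectation (\<lambda>\<omega>. real (max_bus n X k \<omega>) / real k)) \<longlonglongrightarrow> real n / (real n + 1)"
    using n by (intro beta_expectation_tendsto MM wM) auto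
  have "integrable M (\<lambda>\<omega>. real (min_bus n X k \<omega>) / real k)" for k
    using m by (intro integrable_const_bound[where B = 1]) auto
  moreover have "integrable M (\<lambda>\<omega>. real (max_bus n X k \<omega>) / real k)" for k
    using MM by (intro integrable_const_bound[where B = 1]) auto
  \<comment> \<open>The two extremes are dependent, but linearity of expectation avoids their joint
    law; integrability comes from boundedness.\<close>
  ultimately have "expectation (\<lambda>\<omega>. bus_range n X k \<omega> / real k) =
      expectation (\<lambda>\<omega>. real (max_bus n X k \<omega>) / real k) - expectation (\<lambda>\<omega>. real (min_bus n X k \<omega>) / real k)" for k
    by (simp add: bus_range_def diff_divide_distrib)
  then have eR: "(\<lambda>k. expectation (\<lambda>\<omega>. bus_range n X k \<omega> / real k)) \<longlonglongrightarrow> (real n - 1) / (real n + 1)"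
    using tendsto_diff[OF eM em] by (simp add: diff_divide_distrib add.commute)
  \<comment> \<open>The limit in \<open>beta_std_dev_tendsto\<close> is symmetric in
    \<open>a\<close> and \<open>b\<close>, so the parameters \<open>1, n\<close> and
    \<open>n, 1\<close> yield the same value.\<close>
  have "(\<lambda>k. std_dev M (\<lambda>\<omega>. real (min_bus n X k \<omega>) / real k)) \<longlonglongrightarrow>
      1 / (1 + real n) * sqrt (1 * real n / (1 + real n + 1))"
    using n by (intro beta_std_dev_tendsto m wm) auto
  moreover have "(\<lambda>k. std_dev M (\<lambda>\<omega>. real (max_bus n X k \<omega>) / real k)) \<longlonglongrightarrow>
      1 / (real n + 1) * sqrt (real n * 1 / (real n + 1 + 1))"
    using n by (intro beta_std_dev_tendsto MM wM) auto
  ultimately show ?thesis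
    unfolding m_def MM_def R_def
    using wm wM em eM eR prob_min_bus_tendsto[OF assms(1)] prob_max_bus_tendsto[OF assms(1)]
    by (simp add: add_ac)
qed

end
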